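(* Let $n \ge 1$ be an integer. If $n$ is even, then $$\max_{M \in \mathcal{S}_n} C_3(M) = \frac{1}{4}\binom{n}{3}.$$ If $n$ is odd, then $$2\binom{\frac{n+1}{2}}{3} \le \max_{M \in \mathcal{S}_n} C_3(M) \le \frac{1}{4}\binom{n}{3}.$$
   Context: A tournament matrix of order $n$ is an $n \times n$ $(0,1)$-matrix $M$ with $M + M^T = J_n - I_n$, where $J_n$ is the all-ones matrix and $I_n$ the identity; it is the adjacency matrix of a tournament (an orientation of the complete graph on $n$ vertices). $\mathcal{S}_n$ denotes the set of singular tournament matrices of order $n$ (singularity over the real/complex numbers). $C_3(M)$ is the number of directed $3$-cycles in the tournament with adjacency matrix $M$, counted as $3$-vertex subsets inducing a directed cycle. Binomial coefficients $\binom{a}{3}$ with $0\le a<3$ are $0$. *)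

theory Defs
  imports "Jordan_Normal_Form.Determinant"
begin

definition all_ones_mat :: "nat \<Rightarrow> real mat" where
  "all_ones_mat n = mat n n (\<lambda>_. 1)"

definition tournament_mat :: "nat \<Rightarrow> real mat \<Rightarrow> bool" where
  "tournament_mat n M \<longleftrightarrow>
     M \<in> carrier_mat n n \<and> elements_mat M \<subseteq> {0, 1} \<and>
     M + transpose_mat M = all_ones_mat n - 1\<^sub>m n"

definition singular_tournament_mats :: "nat \<Rightarrow> real mat set" where
  "singular_tournament_mats n = {M. tournament_mat n M \<and> det M = 0}"

definition three_cycles :: "real mat \<Rightarrow> nat set set" where
  "three_cycles M =
     {T. T \<subseteq> {..<dim_row M} \<and> card T = 3 \<and>
         (\<exists>i j k. T = {i, j, k} \<and> M $$ (i, j) = 1 \<and> M $$ (j, k) = 1 \<and> M $$ (k, i) = 1)}"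

definition C3 :: "real mat \<Rightarrow> nat" where
  "C3 M = card (three_cycles M)"

text \<open>
  The next two facts show that the maximum of \<^const>\<open>C3\<close> over the singular tournament
  matrices of order \<open>n \<ge> 1\<close> exists, so that \<^const>\<open>Max\<close> has its intended meaning.
\<close>

lemma finite_C3_singular_tournament_mats: "finite (C3 ` singular_tournament_mats n)"
proof (rule finite_subset)
  show "C3 ` singular_tournament_mats n \<subseteq> {..2 ^ n}"
  proof clarify
    fix M assume "M \<in> singular_tournament_mats n"
    then have "dim_row M = n"
      by (auto simp: singular_tournament_mats_def tournament_mat_def)
    then have "three_cycles M \<subseteq> Pow {..<n}"
      by (auto simp: three_cycles_def)
    then have "card (three_cycles M) \<le> card (Pow {..<n})"
      by (intro card_mono) auto
    then show "C3 M \<le> 2 ^ n"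
      by (simp add: C3_def card_Pow)
  qed
qed simp

lemma singular_tournament_mats_nonempty:
  assumes "n \<ge> 1"
  shows "singular_tournament_mats n \<noteq> {}"
proof -
  let ?M = "mat n n (\<lambda>(i, j). if i < j then 1 else 0) :: real mat"
  have M: "?M \<in> carrier_mat n n" by simp
  have "det ?M = prod_list (diag_mat ?M)"
    by (rule det_upper_triangular[OF _ M]) auto
  moreover have "0 \<in> set (diag_mat ?M)"
    using assms by (auto simp: diag_mat_def intro!: image_eqI[of _ _ 0])
  ultimately have "det ?M = 0" by (simp add: prod_list_zero_iff)
  moreover have "elements_mat ?M \<subseteq> {0, 1}"
    by (auto simp: elements_mat_def)
  moreover have "?M + transpose_mat ?M = all_ones_mat n - 1\<^sub>m n"
    by (rule eq_matI) (auto simp: all_ones_mat_def)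
  ultimately have "?M \<in> singular_tournament_mats n"
    using M by (simp add: singular_tournament_mats_def tournament_mat_def)
  then show ?thesis by blast
qed

end

theory Submission
  imports Defs
begin

text \<open>
  A triple of vertices is cyclic unless one of its vertices beats the two others, so
  \<open>C3 M = (n choose 3) - (\<Sum>i<n. s i choose 2)\<close> for the score sequence \<open>s\<close>. If \<open>M x = 0\<close>
  and \<open>x \<noteq> 0\<close>, then \<open>M + M\<^sup>T = J - I\<close> shows that \<open>(\<Sum>i<n. x i)\<^sup>2 = (\<Sum>i<n. (x i)\<^sup>2)\<close> and,
  after scaling to \<open>(\<Sum>i<n. x i) = 1\<close>, that \<open>(\<Sum>i<n. s i * x i) = n - 1\<close>. The Cauchy-Schwarz
  inequality then bounds \<open>\<Sum>i<n. (s i)\<^sup>2\<close> from below, with equality if and only if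
  \<open>s i = (n - 2) / 2 + n / 2 * x i\<close>. Adding a source to an (almost) regular tournament on
  \<open>n - 1\<close> vertices gives a singular tournament matrix; it attains equality if \<open>n\<close> is even.
\<close>

section \<open>Binomial polynomials and entries of tournament matrices\<close>

lemma real_choose_two: "real (n choose 2) = real n * (real n - 1) / 2"
proof (induction n)
  case (Suc n)
  have "Suc n choose 2 = n + (n choose 2)"
    by (simp add: numeral_2_eq_2)
  with Suc show ?case by (simp add: field_simps)
qed simp

lemma real_choose_three: "real (n choose 3) = real n * (real n - 1) * (real n - 2) / 6"
proof (induction n)
  case (Suc n)
  have "Suc n choose 3 = (n choose 2) + (n choose 3)"
    by (simp add: numeral_2_eq_2 numeral_3_eq_3)
  with Suc real_choose_two[of n] show ?case by (simp add: field_simps)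
qed simp

lemma tournament_mat_carrier:
  "tournament_mat n M \<Longrightarrow> M \<in> carrier_mat n n"
  by (simp add: tournament_mat_def)

lemma tournament_mat_entry:
  assumes "tournament_mat n M" "i < n" "j < n"
  shows "M $$ (i, j) = 0 \<or> M $$ (i, j) = 1"
proof -
  have "M $$ (i, j) \<in> elements_mat M"
    using assms by (auto simp: tournament_mat_def intro: elements_matI)
  then show ?thesis using assms by (auto simp: tournament_mat_def)
qed

lemma tournament_mat_skew:
  assumes "tournament_mat n M" "i < n" "j < n"
  shows "M $$ (i, j) + M $$ (j, i) = (if i = j then 0 else 1)"
proof -
  have M: "M \<in> carrier_mat n n" and eq: "M + transpose_mat M = all_ones_mat n - 1\<^sub>m n"
    using assms by (auto simp: tournament_mat_def)
  have "(M + transpose_mat M) $$ (i, j) = (all_ones_mat n - 1\<^sub>m n) $$ (i, j)"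
    by (simp add: eq)
  then show ?thesis using M assms by (auto simp: all_ones_mat_def)
qed

section \<open>Scores and the count of three-cycles\<close>

definition out_nbrs :: "real mat \<Rightarrow> nat \<Rightarrow> nat set" where
  "out_nbrs M i = {j. j < dim_col M \<and> M $$ (i, j) = 1}"

lemma finite_out_nbrs [simp]: "finite (out_nbrs M i)"
  by (simp add: out_nbrs_def)

text \<open>Links the score as a cardinality, used for counting triples, to the row sum, used in the
  linear algebra.\<close>

lemma card_out_nbrs:
  assumes "tournament_mat n M" "i < n"
  shows "real (card (out_nbrs M i)) = (\<Sum>j<n. M $$ (i, j))"
proof -
  have "dim_col M = n" using tournament_mat_carrier[OF assms(1)] by simp
  then have sub: "out_nbrs M i \<subseteq> {..<n}" by (auto simp: out_nbrs_def)
  have "(\<Sum>j<n. M $$ (i, j)) = (\<Sum>j\<in>out_nbrs M i. M $$ (i, j))"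
    using tournament_mat_entry[OF assms] sub \<open>dim_col M = n\<close>
    by (intro sum.mono_neutral_right) (auto simp: out_nbrs_def)
  also have "\<dots> = (\<Sum>j\<in>out_nbrs M i. 1)"
    by (intro sum.cong) (auto simp: out_nbrs_def)
  finally show ?thesis by simp
qed

text \<open>A triple that is not cyclic is transitive and has exactly one source; grouping such
  triples by their source \<open>i\<close> leaves a free choice of two out-neighbours of
  \<open>i\<close>. The additive form avoids truncated subtraction.\<close>

lemma card_three_cycles_add_dominated:
  assumes M: "tournament_mat n M"
  shows "C3 M + (\<Sum>i<n. card (out_nbrs M i) choose 2) = n choose 3"
proof -
  define D where "D i = insert i ` {P. P \<subseteq> out_nbrs M i \<and> card P = 2}" for i
  define A where "A = {T. T \<subseteq> {..<n} \<and> card T = 3}"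
  have dims: "dim_row M = n" "dim_col M = n" using tournament_mat_carrier[OF M] by auto
  note entry = tournament_mat_entry[OF M] and skew = tournament_mat_skew[OF M]
  have irrefl: "M $$ (i, i) = 0" if "i < n" for i
    using skew[OF that that] by simp
  have self: "i \<notin> out_nbrs M i" for i
    using irrefl[of i] by (auto simp: out_nbrs_def dims)
  have asym: "\<not> (M $$ (i, j) = 1 \<and> M $$ (j, i) = 1)" if "i < n" "j < n" for i j
    using skew[OF that] by (auto split: if_splits)
  have total: "M $$ (i, j) = 1 \<or> M $$ (j, i) = 1" if "i < n" "j < n" "i \<noteq> j" for i j
    using skew[OF that(1,2)] entry[OF that(1,2)] that by auto
  have D_iff: "T \<in> D i \<longleftrightarrow>
      (\<exists>j k. T = {i, j, k} \<and> j \<noteq> k \<and> j \<in> out_nbrs M i \<and> k \<in> out_nbrs M i)" for T i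
    by (auto simp: D_def card_2_iff)
  have DA: "D i \<subseteq> A" if "i < n" for i
  proof
    fix T assume "T \<in> D i"
    then obtain j k where "T = {i, j, k}" "j \<noteq> k" "j \<in> out_nbrs M i" "k \<in> out_nbrs M i"
      unfolding D_iff by blast
    with self[of i] that show "T \<in> A"
      by (auto simp: A_def out_nbrs_def dims card_insert_if)
  qed
  have D_disj: "D i \<inter> D i' = {}" if "i < n" "i' < n" "i \<noteq> i'" for i i'
  proof -
    \<comment> \<open>Such a triple contains both \<open>i\<close> and \<open>i'\<close>, so each of
      them would beat the other.\<close>
    have False if "T \<in> D i" "T \<in> D i'" for T
    proof -
      have "i' \<in> out_nbrs M i" "i \<in> out_nbrs M i'"
        using that \<open>i \<noteq> i'\<close> unfolding D_iff by auto
      with asym[of i i'] \<open>i < n\<close> \<open>i' < n\<close> show False by (auto simp: out_nbrs_def)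
    qed
    then show ?thesis by blast
  qed
  have cyc_disj: "three_cycles M \<inter> (\<Union>i<n. D i) = {}"
  proof -
    have False if T: "T \<in> three_cycles M" and TD: "T \<in> D v" and v: "v < n" for T v
    proof -
      obtain i j k where ijk: "T = {i, j, k}" "M $$ (i, j) = 1" "M $$ (j, k) = 1"
        "M $$ (k, i) = 1" and "T \<subseteq> {..<n}"
        using T unfolding three_cycles_def dims by blast
      then have lt: "i < n" "j < n" "k < n" by auto
      have vT: "v \<in> T" and dom: "\<And>w. w \<in> T \<Longrightarrow> w \<noteq> v \<Longrightarrow> M $$ (v, w) = 1"
        using TD unfolding D_iff by (auto simp: out_nbrs_def)
      \<comment> \<open>Every vertex of a directed cycle has a predecessor on it, which contradicts
        that \<open>v\<close> beats both others.\<close>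
      obtain u where u: "u \<in> T" "M $$ (u, v) = 1"
        using vT ijk by auto
      then have "u < n" "u \<noteq> v" using \<open>T \<subseteq> {..<n}\<close> irrefl[OF v] by auto
      with dom[OF u(1)] asym[of u v] u v show False by auto
    qed
    then show ?thesis by blast
  qed
  have cover: "A = three_cycles M \<union> (\<Union>i<n. D i)"
  proof (intro equalityI subsetI)
    fix T assume "T \<in> A"
    then have "T \<subseteq> {..<n}" "card T = 3" by (auto simp: A_def)
    from this(2) obtain i j k where T: "T = {i, j, k}" "i \<noteq> j" "j \<noteq> k" "i \<noteq> k"
      by (auto simp: card_3_iff)
    with \<open>T \<subseteq> {..<n}\<close> have lt: "i < n" "j < n" "k < n" by auto
    have cyc: "T \<in> three_cycles M"
      if "T = {a, b, c}" "M $$ (a, b) = 1" "M $$ (b, c) = 1" "M $$ (c, a) = 1" for a b c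
      using that \<open>T \<subseteq> {..<n}\<close> \<open>card T = 3\<close> unfolding three_cycles_def dims by blast
    have dom: "T \<in> (\<Union>i<n. D i)"
      if "T = {a, b, c}" "b \<noteq> c" "a < n" "b < n" "c < n" "M $$ (a, b) = 1" "M $$ (a, c) = 1"
      for a b c
    proof -
      have "T \<in> D a" unfolding D_iff using that by (auto simp: out_nbrs_def dims)
      with \<open>a < n\<close> show ?thesis by blast
    qed
    have perms: "T = {j, k, i}" "T = {k, i, j}" "T = {k, j, i}" "T = {j, i, k}" "T = {i, k, j}"
      using T by auto
    \<comment> \<open>Three edges have eight orientations: six give one of the three vertices as a
      source, two are cyclic.\<close>
    consider "M $$ (i, j) = 1" "M $$ (i, k) = 1" | "M $$ (j, i) = 1" "M $$ (j, k) = 1"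
      | "M $$ (k, i) = 1" "M $$ (k, j) = 1"
      | "M $$ (i, j) = 1" "M $$ (j, k) = 1" "M $$ (k, i) = 1"
      | "M $$ (i, k) = 1" "M $$ (k, j) = 1" "M $$ (j, i) = 1"
      using total[OF lt(1,2) T(2)] total[OF lt(2,3) T(3)] total[OF lt(1,3) T(4)] by blast
    then show "T \<in> three_cycles M \<union> (\<Union>i<n. D i)"
    proof cases
      case 1 then show ?thesis using dom[OF T(1) T(3) lt] by blast
    next
      case 2 then show ?thesis using dom[OF perms(4) T(4) lt(2,1,3)] by blast
    next
      case 3 then show ?thesis using dom[OF perms(2) T(2) lt(3,1,2)] by blast
    next
      case 4 then show ?thesis using cyc[OF T(1)] by blast
    next
      case 5 then show ?thesis using cyc[OF perms(5)] by blast
    qed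
  next
    fix T assume "T \<in> three_cycles M \<union> (\<Union>i<n. D i)"
    then show "T \<in> A" using DA by (auto simp: three_cycles_def dims A_def)
  qed
  have "finite A" unfolding A_def by simp
  have card_D: "card (D i) = card (out_nbrs M i) choose 2" for i
  proof -
    \<comment> \<open>The pair can be recovered from the triple because \<open>i\<close> is not its
      own out-neighbour.\<close>
    have "inj_on (insert i) {P. P \<subseteq> out_nbrs M i \<and> card P = 2}"
    proof (rule inj_onI)
      fix P Q
      assume "P \<in> {P. P \<subseteq> out_nbrs M i \<and> card P = 2}"
        "Q \<in> {P. P \<subseteq> out_nbrs M i \<and> card P = 2}" "insert i P = insert i Q"
      with self[of i] show "P = Q" by (metis insert_ident mem_Collect_eq subsetD)
    qed
    then show ?thesis by (simp add: D_def card_image n_subsets)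
  qed
  have "card A = card (three_cycles M) + card (\<Union>i<n. D i)"
    unfolding cover using \<open>finite A\<close> cyc_disj unfolding cover
    by (intro card_Un_disjoint) auto
  also have "card (\<Union>i<n. D i) = (\<Sum>i<n. card (D i))"
    using D_disj finite_subset[OF DA \<open>finite A\<close>] by (intro card_UN_disjoint) auto
  also have "card A = n choose 3" by (simp add: A_def n_subsets)
  finally show ?thesis by (simp add: C3_def card_D)
qed

lemma real_C3:
  assumes "tournament_mat n M"
  shows "real (C3 M) = real (n choose 3) -
    (\<Sum>i<n. real (card (out_nbrs M i)) * (real (card (out_nbrs M i)) - 1) / 2)"
proof -
  have "real (n choose 3) = real (C3 M + (\<Sum>i<n. card (out_nbrs M i) choose 2))"
    using card_three_cycles_add_dominated[OF assms] by simp
  then show ?thesis by (simp add: real_choose_two)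
qed

section \<open>The upper bound from a kernel vector\<close>

lemma sum_squares_scores_singular:
  fixes n :: nat and a :: "nat \<Rightarrow> nat \<Rightarrow> real" and x :: "nat \<Rightarrow> real"
  defines "s \<equiv> \<lambda>i. \<Sum>j<n. a i j"
  assumes skew: "\<And>i j. i < n \<Longrightarrow> j < n \<Longrightarrow> a i j + a j i = (if i = j then 0 else 1)"
    and ker: "\<And>i. i < n \<Longrightarrow> (\<Sum>j<n. a i j * x j) = 0"
    and nz: "\<exists>i<n. x i \<noteq> 0"
  shows "(\<Sum>i<n. s i) = real n * (real n - 1) / 2"
    and "(\<Sum>i<n. (s i)\<^sup>2) \<ge> (real n)\<^sup>2 * (real n - 1) / 4"
proof -
  define X where "X = (\<Sum>i<n. x i)"
  \<comment> \<open>This pairs the identity M + M^T = J - I with an arbitrary weight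
    \<open>f\<close>. The weights 1, \<open>x i * x j\<close> and \<open>x i\<close> yield
    \<open>sum_s\<close>, \<open>sq\<close> and \<open>sx\<close>.\<close>
  have weighted: "(\<Sum>i<n. \<Sum>j<n. a i j * f i j) + (\<Sum>i<n. \<Sum>j<n. a i j * f j i) =
      (\<Sum>i<n. \<Sum>j<n. f i j) - (\<Sum>i<n. f i i)" for f :: "nat \<Rightarrow> nat \<Rightarrow> real"
  proof -
    have "(\<Sum>i<n. \<Sum>j<n. a i j * f j i) = (\<Sum>i<n. \<Sum>j<n. a j i * f i j)"
      by (rule sum.swap)
    then have "(\<Sum>i<n. \<Sum>j<n. a i j * f i j) + (\<Sum>i<n. \<Sum>j<n. a i j * f j i) =
        (\<Sum>i<n. \<Sum>j<n. (a i j + a j i) * f i j)"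
      by (simp add: sum.distrib distrib_right)
    also have "\<dots> = (\<Sum>i<n. \<Sum>j<n. f i j - (if i = j then f i j else 0))"
      by (intro sum.cong refl) (simp add: skew)
    also have "\<dots> = (\<Sum>i<n. \<Sum>j<n. f i j) - (\<Sum>i<n. f i i)"
      by (simp add: sum_subtractf sum.delta)
    finally show ?thesis .
  qed
  show sum_s: "(\<Sum>i<n. s i) = real n * (real n - 1) / 2"
    using weighted[of "\<lambda>_ _. 1"] by (simp add: s_def field_simps)
  have sq: "(\<Sum>i<n. (x i)\<^sup>2) = X\<^sup>2"
  proof -
    have "(\<Sum>i<n. \<Sum>j<n. a i j * (x i * x j)) = (\<Sum>i<n. x i * (\<Sum>j<n. a i j * x j))"
      by (simp add: sum_distrib_left mult_ac)
    also have "\<dots> = 0" by (simp add: ker)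
    finally have z: "(\<Sum>i<n. \<Sum>j<n. a i j * (x i * x j)) = 0" .
    then have "(\<Sum>i<n. \<Sum>j<n. a i j * (x j * x i)) = 0" by (simp add: mult.commute)
    with z weighted[of "\<lambda>i j. x i * x j"]
    have "(\<Sum>i<n. \<Sum>j<n. x i * x j) = (\<Sum>i<n. x i * x i)" by simp
    then show ?thesis by (simp add: X_def power2_eq_square sum_product)
  qed
  have sx: "(\<Sum>i<n. s i * x i) = (real n - 1) * X"
  proof -
    \<comment> \<open>For the weight \<open>x i\<close> the transposed sum is this one, so only the
      score sum survives on the left.\<close>
    have "(\<Sum>i<n. \<Sum>j<n. a i j * x j) = 0" by (simp add: ker)
    with weighted[of "\<lambda>i j. x i"] show ?thesis
      by (simp add: s_def sum_distrib_right X_def flip: sum_distrib_left)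
         (simp add: algebra_simps)
  qed
  have "(\<Sum>i<n. (x i)\<^sup>2) \<noteq> 0"
    using nz by (auto simp: sum_nonneg_eq_0_iff)
  with sq have X: "X\<^sup>2 > 0" by simp
  \<comment> \<open>Cauchy-Schwarz in explicit form: the coefficients make the deviation orthogonal
    to the constant vector and to \<open>x\<close>. Multiplying \<open>s i\<close> by
    \<open>X\<close> replaces the scaling to \<open>X = 1\<close>.\<close>
  have "0 \<le> (\<Sum>i<n. (s i * X - (real n - 2) / 2 * X - real n / 2 * x i)\<^sup>2)"
    by (intro sum_nonneg) simp
  also have "\<dots> = (\<Sum>i<n. X\<^sup>2 * (s i)\<^sup>2 - (real n - 2) * X\<^sup>2 * s i - real n * X * (s i * x i) +
      (real n - 2)\<^sup>2 / 4 * X\<^sup>2 + real n * (real n - 2) / 2 * X * x i + (real n)\<^sup>2 / 4 * (x i)\<^sup>2)"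
    by (intro sum.cong refl) (simp add: power2_eq_square field_simps)
  also have "\<dots> = X\<^sup>2 * (\<Sum>i<n. (s i)\<^sup>2) - (real n - 2) * X\<^sup>2 * (\<Sum>i<n. s i)
      - real n * X * (\<Sum>i<n. s i * x i) + (real n - 2)\<^sup>2 / 4 * (real n * X\<^sup>2)
      + real n * (real n - 2) / 2 * X * (\<Sum>i<n. x i) + (real n)\<^sup>2 / 4 * (\<Sum>i<n. (x i)\<^sup>2)"
    by (simp only: sum.distrib sum_subtractf sum_distrib_left[symmetric] sum_constant card_lessThan)
  also have "\<dots> = X\<^sup>2 * ((\<Sum>i<n. (s i)\<^sup>2) - (real n)\<^sup>2 * (real n - 1) / 4)"
    unfolding sum_s sx sq X_def[symmetric] by (simp add: power2_eq_square field_simps)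
  finally show "(\<Sum>i<n. (s i)\<^sup>2) \<ge> (real n)\<^sup>2 * (real n - 1) / 4"
    using X by (simp add: zero_le_mult_iff)
qed

text \<open>The sum of the scores is fixed, so \<open>C3 M\<close> decreases as the sum of their
  squares grows, and a lower bound on the squares bounds \<open>C3 M\<close> from above.\<close>

lemma C3_singular_le:
  assumes "M \<in> singular_tournament_mats n"
  shows "real (C3 M) \<le> 1 / 4 * real (n choose 3)"
proof -
  have M: "tournament_mat n M" and "det M = 0"
    using assms by (auto simp: singular_tournament_mats_def)
  note carrier = tournament_mat_carrier[OF M]
  obtain v where v: "v \<in> carrier_vec n" "v \<noteq> 0\<^sub>v n" "M *\<^sub>v v = 0\<^sub>v n"
    using det_0_iff_vec_prod_zero[OF carrier] \<open>det M = 0\<close> by auto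
  define s where "s i = (\<Sum>j<n. M $$ (i, j))" for i
  have ker: "(\<Sum>j<n. M $$ (i, j) * v $ j) = 0" if "i < n" for i
  proof -
    have "(\<Sum>j<n. M $$ (i, j) * v $ j) = (M *\<^sub>v v) $ i"
      using carrier v(1) that by (simp add: scalar_prod_def lessThan_atLeast0)
    then show ?thesis using v(3) that by simp
  qed
  have nz: "\<exists>i<n. v $ i \<noteq> 0"
    using v by (metis carrier_vecD eq_vecI index_zero_vec)
  have scores: "(\<Sum>i<n. s i) = real n * (real n - 1) / 2"
    "(\<Sum>i<n. (s i)\<^sup>2) \<ge> (real n)\<^sup>2 * (real n - 1) / 4"
    using sum_squares_scores_singular[of n "\<lambda>i j. M $$ (i, j)" "\<lambda>j. v $ j"]
      tournament_mat_skew[OF M] ker nz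
    by (simp_all add: s_def)
  have "real (C3 M) = real (n choose 3) - (\<Sum>i<n. s i * (s i - 1) / 2)"
    unfolding real_C3[OF M] by (simp add: card_out_nbrs[OF M] s_def)
  also have "(\<Sum>i<n. s i * (s i - 1) / 2) = ((\<Sum>i<n. (s i)\<^sup>2) - (\<Sum>i<n. s i)) / 2"
    by (simp add: sum_divide_distrib sum_subtractf[symmetric] power2_eq_square algebra_simps)
  also have "real (n choose 3) - \<dots> \<le>
      real (n choose 3) - ((real n)\<^sup>2 * (real n - 1) / 4 - real n * (real n - 1) / 2) / 2"
    unfolding scores(1)
    using scores(2) by (intro diff_left_mono divide_right_mono diff_right_mono) auto
  also have "\<dots> = 1 / 4 * real (n choose 3)"
    by (simp add: real_choose_three power2_eq_square field_simps)
  finally show ?thesis .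
qed

section \<open>Singular tournaments with many three-cycles\<close>

text \<open>
  Vertex \<open>m\<close> is a source. Among the vertices below \<open>m\<close>, the smaller one wins if and only if the
  difference is odd, which makes the scores as equal as possible.
\<close>

definition source_parity_mat :: "nat \<Rightarrow> real mat" where
  "source_parity_mat m = mat (Suc m) (Suc m) (\<lambda>(i, j).
     if j = m then 0 else if i = m then 1
     else if i < j \<and> odd (j - i) \<or> j < i \<and> even (i - j) then 1 else 0)"

lemma tournament_source_parity_mat: "tournament_mat (Suc m) (source_parity_mat m)"
  unfolding tournament_mat_def
proof (intro conjI)
  show "source_parity_mat m \<in> carrier_mat (Suc m) (Suc m)"
    by (simp add: source_parity_mat_def)
  show "elements_mat (source_parity_mat m) \<subseteq> {0, 1}"
    by (auto simp: elements_mat_def source_parity_mat_def)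
  show "source_parity_mat m + transpose_mat (source_parity_mat m) =
      all_ones_mat (Suc m) - 1\<^sub>m (Suc m)"
    by (rule eq_matI) (auto simp: source_parity_mat_def all_ones_mat_def)
qed

text \<open>Nobody beats the source \<open>m\<close>, so column \<open>m\<close> is zero and the
  unit vector at \<open>m\<close> lies in the kernel.\<close>

lemma singular_source_parity_mat: "source_parity_mat m \<in> singular_tournament_mats (Suc m)"
proof -
  have carrier: "source_parity_mat m \<in> carrier_mat (Suc m) (Suc m)"
    by (simp add: source_parity_mat_def)
  have "source_parity_mat m *\<^sub>v unit_vec (Suc m) m = 0\<^sub>v (Suc m)"
    by (rule eq_vecI) (auto simp: source_parity_mat_def)
  then have "det (source_parity_mat m) = 0"
    using det_0_iff_vec_prod_zero[OF carrier] unit_vec_nonzero[of m "Suc m"]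
    by (auto intro!: exI[of _ "unit_vec (Suc m) m"])
  then show ?thesis
    using tournament_source_parity_mat by (simp add: singular_tournament_mats_def)
qed

text \<open>Wins of \<open>i\<close> against larger vertices, used with \<open>d = m - i\<close>;
  the offset \<open>d\<close> lets induction move the upper end alone.\<close>

lemma card_odd_gaps_above: "card {j. i < j \<and> j < i + d \<and> odd (j - i)} = d div 2" for i d :: nat
proof (induction d)
  case (Suc d)
  have "{j. i < j \<and> j < i + Suc d \<and> odd (j - i)} =
      (if odd d then insert (i + d) {j. i < j \<and> j < i + d \<and> odd (j - i)}
       else {j. i < j \<and> j < i + d \<and> odd (j - i)})"
    by (auto simp: less_Suc_eq intro: Nat.gr0I)
  with Suc show ?case by auto
qed simp

lemma card_even_gaps_below: "card {j. j < i \<and> even (i - j)} = i div 2" for i :: nat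
proof (induction i rule: nat_less_induct)
  case (1 i)
  show ?case
  proof (cases "i < 2")
    case True
    then have "{j. j < i \<and> even (i - j)} = {}" by (auto simp: less_2_cases_iff)
    with True show ?thesis by simp
  next
    case False
    then obtain k where k: "i = k + 2" by (metis add.commute le_Suc_ex not_less)
    \<comment> \<open>Moving the end by two keeps the parity of every gap; of the two new candidates
      only \<open>k\<close> has an even gap.\<close>
    have "{j. j < i \<and> even (i - j)} = insert k {j. j < k \<and> even (k - j)}"
      by (auto simp: k less_Suc_eq Suc_diff_le)
    with 1 k show ?thesis by simp
  qed
qed

lemma card_out_nbrs_source_parity:
  "card (out_nbrs (source_parity_mat m) m) = m"
  "i < m \<Longrightarrow> card (out_nbrs (source_parity_mat m) i) = (m - i) div 2 + i div 2"
proof -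
  have "out_nbrs (source_parity_mat m) m = {..<m}"
    by (auto simp: out_nbrs_def source_parity_mat_def split: if_splits)
  then show "card (out_nbrs (source_parity_mat m) m) = m" by simp
next
  assume "i < m"
  let ?above = "{j. i < j \<and> j < i + (m - i) \<and> odd (j - i)}"
  let ?below = "{j. j < i \<and> even (i - j)}"
  have "out_nbrs (source_parity_mat m) i = ?above \<union> ?below"
    using \<open>i < m\<close>
    by (auto simp: out_nbrs_def source_parity_mat_def split: if_splits)
  moreover have "card (?above \<union> ?below) = card ?above + card ?below"
    by (rule card_Un_disjoint) auto
  ultimately show "card (out_nbrs (source_parity_mat m) i) = (m - i) div 2 + i div 2"
    by (simp only: card_odd_gaps_above card_even_gaps_below)
qed

text \<open>For \<open>m = 2 * k\<close> the scores below the source depend only on the parity of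
  the vertex.\<close>

lemma sum_parity:
  fixes g :: "nat \<Rightarrow> real"
  shows "(\<Sum>i<2 * k. g (i mod 2)) = real k * (g 0 + g 1)"
proof (induction k)
  case (Suc k)
  have "2 * Suc k = Suc (Suc (2 * k))" by simp
  with Suc show ?case by (simp add: distrib_right)
qed simp

lemma C3_source_parity_mat:
  "real (C3 (source_parity_mat m)) = real (Suc m choose 3) - real m * (real m - 1) / 2 -
    (\<Sum>i<m. real ((m - i) div 2 + i div 2) * (real ((m - i) div 2 + i div 2) - 1) / 2)"
  unfolding real_C3[OF tournament_source_parity_mat]
  by (simp add: card_out_nbrs_source_parity)

text \<open>Here \<open>i\<close> and \<open>2 * k + 1 - i\<close> have opposite parity, so rounding
  loses exactly one half in total and every score below the source is \<open>k\<close>.\<close>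

lemma C3_source_parity_mat_odd:
  "real (C3 (source_parity_mat (2 * k + 1))) = 1 / 4 * real ((2 * k + 2) choose 3)"
proof -
  have "(2 * k + 1 - i) div 2 + i div 2 = k" if "i < 2 * k + 1" for i
    using that by (cases "even i") (auto elim!: evenE oddE)
  then have "real (C3 (source_parity_mat (2 * k + 1))) = real (Suc (2 * k + 1) choose 3)
      - real (2 * k + 1) * (real (2 * k + 1) - 1) / 2
      - (\<Sum>i<2 * k + 1. real k * (real k - 1) / 2)"
    unfolding C3_source_parity_mat by (intro arg_cong2[where f = minus] sum.cong refl) auto
  then show ?thesis by (simp add: real_choose_three field_simps)
qed

text \<open>An even number of vertices admits no regular tournament: even \<open>i\<close> gets
  score \<open>k\<close>, odd \<open>i\<close> gets \<open>k - 1\<close>.\<close>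

lemma C3_source_parity_mat_even:
  "real (C3 (source_parity_mat (2 * k))) = 2 * real ((k + 1) choose 3)"
proof -
  define g where "g r = (real k - real r) * (real k - real r - 1) / 2" for r :: nat
  have "real ((2 * k - i) div 2 + i div 2) = real k - real (i mod 2)" if "i < 2 * k" for i
  proof -
    have "i div 2 < k" using that by (simp add: div_less_iff_less_mult mult.commute)
    \<comment> \<open>Writing \<open>k\<close> through \<open>c\<close> makes the truncated
      differences explicit before halving.\<close>
    then obtain c where c: "k = Suc (i div 2 + c)"
      using less_iff_Suc_add by auto
    have "2 * k - i = 2 * c + 2 - i mod 2"
      using c div_mult_mod_eq[of i 2] by linarith
    then have "(2 * k - i) div 2 = Suc c - i mod 2"
      by (cases "even i") (simp_all add: mod_2_eq_odd)
    then show ?thesis using c by (cases "even i") (simp_all add: mod_2_eq_odd)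
  qed
  then have "real (C3 (source_parity_mat (2 * k))) = real (Suc (2 * k) choose 3)
      - real (2 * k) * (real (2 * k) - 1) / 2 - (\<Sum>i<2 * k. g (i mod 2))"
    unfolding C3_source_parity_mat g_def
    by (intro arg_cong2[where f = minus] sum.cong refl) auto
  then show ?thesis
    unfolding sum_parity by (simp add: g_def real_choose_three field_simps)
qed

theorem proposition2p4:
  fixes n :: nat
  assumes "n \<ge> 1"
  shows "(even n \<longrightarrow>
            real (Max (C3 ` singular_tournament_mats n)) = 1 / 4 * real (n choose 3)) \<and>
         (odd n \<longrightarrow>
            2 * real (((n + 1) div 2) choose 3) \<le> real (Max (C3 ` singular_tournament_mats n)) \<and>
            real (Max (C3 ` singular_tournament_mats n)) \<le> 1 / 4 * real (n choose 3))"
proof -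
  let ?max = "Max (C3 ` singular_tournament_mats n)"
  have "?max \<in> C3 ` singular_tournament_mats n"
    using finite_C3_singular_tournament_mats singular_tournament_mats_nonempty[OF assms]
    by (intro Max_in) auto
  then have upper: "real ?max \<le> 1 / 4 * real (n choose 3)"
    using C3_singular_le by auto
  have lower: "real (C3 (source_parity_mat m)) \<le> real ?max" if "n = Suc m" for m
    unfolding of_nat_le_iff that
    by (intro Max_ge finite_C3_singular_tournament_mats imageI singular_source_parity_mat)
  show ?thesis
  proof (intro conjI impI)
    assume "even n"
    \<comment> \<open>A positive even \<open>n\<close> is at least 2, so removing the source leaves
      the odd number \<open>2 * k + 1\<close>.\<close>
    with assms obtain k where k: "n = 2 * k + 2"
      by (metis One_nat_def Suc_le_eq add_2_eq_Suc' dvd_def gr0_implies_Suc mult_Suc_right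
          nat_0_less_mult_iff add.commute)
    then have "1 / 4 * real (n choose 3) \<le> real ?max"
      using lower[of "2 * k + 1"] C3_source_parity_mat_odd[of k] by simp
    with upper show "real ?max = 1 / 4 * real (n choose 3)" by simp
  next
    assume "odd n"
    \<comment> \<open>Now \<open>(n + 1) div 2\<close> is \<open>k + 1\<close>, and
      \<open>2 * k\<close> vertices remain below the source.\<close>
    then obtain k where k: "n = 2 * k + 1" by (elim oddE)
    then show "2 * real (((n + 1) div 2) choose 3) \<le> real ?max"
      using lower[of "2 * k"] C3_source_parity_mat_even[of k] by simp
  qed (rule upper)
qed

end
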